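(* Let $\Gamma$ be a Carter diagram, $S=\{\tau_1,\dots,\tau_l\}\subset\varPhi$ a $\Gamma$-set, and $\tau_i\in S$. If $u^{\nabla}$ is a linkage label vector (of a linkage root $u$ for $S$), then the values $(s^*_{\tau_i}u^{\nabla})_{\tau_k}$, $k=1,\dots,l$, belong to the set $\{-1,0,1\}$, i.e. $s^*_{\tau_i}u^{\nabla}$ is again a linkage label vector.
   Context: $\varPhi$ is a finite simply-laced root system with inner product $(\cdot,\cdot)$, $(\alpha,\alpha)=2$ for every root. A Carter diagram $\Gamma$ is a graph with solid and dotted edges whose nodes correspond to linearly independent roots $\tau_1,\dots,\tau_l$, with $\tau_i,\tau_j$ joined by a solid edge iff $(\tau_i,\tau_j)=-1$, by a dotted edge iff $(\tau_i,\tau_j)=1$, not joined iff $(\tau_i,\tau_j)=0$, all cycles having an even number of nodes; such a set of roots is a $\Gamma$-set. A linkage root for $S$ is a root $u\in\varPhi$ such that $S\cup\{u\}$ is linearly independent; its linkage label vector is $u^{\nabla}=((u,\tau_1),\dots,(u,\tau_l))^t$, with coordinates $u^{\nabla}_{\tau_k}=(u,\tau_k)\in\{-1,0,1\}$. The dual reflection $s^*_{\tau_i}$ acts on label vectors by $(s^*_{\tau_i}u^{\nabla})_{\tau_k}=u^{\nabla}_{\tau_k}-u^{\nabla}_{\tau_i}(\tau_i,\tau_k)$. *)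

theory Defs
  imports "HOL-Analysis.Analysis"
begin

definition refl_root :: "'a::euclidean_space \<Rightarrow> 'a \<Rightarrow> 'a" where
  "refl_root \<alpha> v = v - (2 * (v \<bullet> \<alpha>) / (\<alpha> \<bullet> \<alpha>)) *\<^sub>R \<alpha>"

definition root_system :: "'a::euclidean_space set \<Rightarrow> bool" where
  "root_system \<Phi> \<longleftrightarrow>
     finite \<Phi> \<and> 0 \<notin> \<Phi> \<and> span \<Phi> = UNIV \<and>
     (\<forall>\<alpha>\<in>\<Phi>. \<forall>c. c *\<^sub>R \<alpha> \<in> \<Phi> \<longrightarrow> c = 1 \<or> c = -1) \<and>
     (\<forall>\<alpha>\<in>\<Phi>. refl_root \<alpha> ` \<Phi> \<subseteq> \<Phi>) \<and>
     (\<forall>\<alpha>\<in>\<Phi>. \<forall>\<beta>\<in>\<Phi>. 2 * (\<beta> \<bullet> \<alpha>) / (\<alpha> \<bullet> \<alpha>) \<in> \<int>)"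

definition simply_laced_root_system :: "'a::euclidean_space set \<Rightarrow> bool" where
  "simply_laced_root_system \<Phi> \<longleftrightarrow> root_system \<Phi> \<and> (\<forall>\<alpha>\<in>\<Phi>. \<alpha> \<bullet> \<alpha> = 2)"

text \<open>The nodes are all elements of the finite index type, which plays the role of
  \<open>{1, \<dots>, l}\<close>; so \<open>l = CARD('n)\<close>.\<close>

record 'n signed_graph =
  solid :: "'n \<Rightarrow> 'n \<Rightarrow> bool"
  dotted :: "'n \<Rightarrow> 'n \<Rightarrow> bool"

definition wf_signed_graph :: "'n::finite signed_graph \<Rightarrow> bool" where
  "wf_signed_graph \<Gamma> \<longleftrightarrow>
     symp (solid \<Gamma>) \<and> irreflp (solid \<Gamma>) \<and> symp (dotted \<Gamma>) \<and> irreflp (dotted \<Gamma>) \<and>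
     (\<forall>i j. \<not> (solid \<Gamma> i j \<and> dotted \<Gamma> i j))"

definition joined :: "'n::finite signed_graph \<Rightarrow> 'n \<Rightarrow> 'n \<Rightarrow> bool" where
  "joined \<Gamma> i j \<longleftrightarrow> solid \<Gamma> i j \<or> dotted \<Gamma> i j"

text \<open>A cycle is given by the list of its pairwise distinct nodes, without repeating the first one.\<close>

definition is_cycle :: "'n::finite signed_graph \<Rightarrow> 'n list \<Rightarrow> bool" where
  "is_cycle \<Gamma> p \<longleftrightarrow>
     3 \<le> length p \<and> distinct p \<and>
     (\<forall>m<length p. joined \<Gamma> (p ! m) (p ! (Suc m mod length p)))"

text \<open>The set \<open>S = {\<tau>\<^sub>1, \<dots>, \<tau>\<^sub>l}\<close> is \<open>range \<tau>\<close>; linear independence of the family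
  includes that the \<open>\<tau> i\<close> are pairwise distinct.\<close>

definition gamma_set ::
    "'a::euclidean_space set \<Rightarrow> 'n::finite signed_graph \<Rightarrow> ('n \<Rightarrow> 'a) \<Rightarrow> bool" where
  "gamma_set \<Phi> \<Gamma> \<tau> \<longleftrightarrow>
     range \<tau> \<subseteq> \<Phi> \<and> inj \<tau> \<and> independent (range \<tau>) \<and>
     (\<forall>i j. i \<noteq> j \<longrightarrow>
        (solid \<Gamma> i j \<longleftrightarrow> \<tau> i \<bullet> \<tau> j = -1) \<and>
        (dotted \<Gamma> i j \<longleftrightarrow> \<tau> i \<bullet> \<tau> j = 1) \<and>
        (\<not> joined \<Gamma> i j \<longleftrightarrow> \<tau> i \<bullet> \<tau> j = 0))"

definition carter_diagram ::
    "'a::euclidean_space set \<Rightarrow> 'n::finite signed_graph \<Rightarrow> bool" where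
  "carter_diagram \<Phi> \<Gamma> \<longleftrightarrow>
     wf_signed_graph \<Gamma> \<and> (\<exists>\<tau>. gamma_set \<Phi> \<Gamma> \<tau>) \<and>
     (\<forall>p. is_cycle \<Gamma> p \<longrightarrow> even (length p))"

text \<open>The condition \<open>u \<notin> range \<tau>\<close> excludes the degenerate case where \<open>u\<close> is itself one of the
  \<open>\<tau> i\<close>: then \<open>insert u (range \<tau>)\<close> is independent as a set, but the family \<open>\<tau>\<^sub>1, \<dots>, \<tau>\<^sub>l, u\<close> is
  not (and the coordinate \<open>u \<bullet> \<tau> i\<close> would be 2).\<close>

definition linkage_root ::
    "'a::euclidean_space set \<Rightarrow> ('n::finite \<Rightarrow> 'a) \<Rightarrow> 'a \<Rightarrow> bool" where
  "linkage_root \<Phi> \<tau> u \<longleftrightarrow>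
     u \<in> \<Phi> \<and> u \<notin> range \<tau> \<and> independent (insert u (range \<tau>))"

definition label_vector :: "('n::finite \<Rightarrow> 'a::euclidean_space) \<Rightarrow> 'a \<Rightarrow> real ^ 'n" where
  "label_vector \<tau> u = (\<chi> k. u \<bullet> \<tau> k)"

definition linkage_label_vector ::
    "'a::euclidean_space set \<Rightarrow> ('n::finite \<Rightarrow> 'a) \<Rightarrow> real ^ 'n \<Rightarrow> bool" where
  "linkage_label_vector \<Phi> \<tau> x \<longleftrightarrow> (\<exists>u. linkage_root \<Phi> \<tau> u \<and> x = label_vector \<tau> u)"

definition dual_reflection ::
    "('n::finite \<Rightarrow> 'a::euclidean_space) \<Rightarrow> 'n \<Rightarrow> real ^ 'n \<Rightarrow> real ^ 'n" where
  "dual_reflection \<tau> i x = (\<chi> k. x $ k - x $ i * (\<tau> i \<bullet> \<tau> k))"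

end

(* The dual reflection of the label vector of u is the label vector of the reflected root
   v = u - (u, \<tau> i) \<tau> i. Since u and v differ by a multiple of \<tau> i, v also lies outside
   the span of the \<tau> k, so v is a linkage root. Distinct non-opposite roots of squared length 2
   have inner product in {-1, 0, 1} by integrality and Cauchy-Schwarz. *)

theory Submission
  imports Defs
begin

lemma simply_laced_inner_cases:
  assumes "simply_laced_root_system \<Phi>" "\<alpha> \<in> \<Phi>" "\<beta> \<in> \<Phi>" "\<alpha> \<noteq> \<beta>" "\<alpha> \<noteq> - \<beta>"
  shows "\<alpha> \<bullet> \<beta> \<in> {-1, 0, 1}"
proof -
  have norms: "\<alpha> \<bullet> \<alpha> = 2" "\<beta> \<bullet> \<beta> = 2"
    using assms by (auto simp: simply_laced_root_system_def)
  \<comment> \<open>Because \<open>\<beta> \<bullet> \<beta> = 2\<close>, this Cartan integer is the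
    inner product itself.\<close>
  have "2 * (\<alpha> \<bullet> \<beta>) / (\<beta> \<bullet> \<beta>) \<in> \<int>"
    using assms by (auto simp: simply_laced_root_system_def root_system_def)
  then obtain n :: int where n: "\<alpha> \<bullet> \<beta> = of_int n"
    by (auto simp: norms elim: Ints_cases)
  \<comment> \<open>Strict Cauchy-Schwarz in disguise: the two squares expand to 4 - 2t and 4 + 2t
    with \<open>t = \<alpha> \<bullet> \<beta>\<close>.\<close>
  have "0 < (\<alpha> - \<beta>) \<bullet> (\<alpha> - \<beta>)" "0 < (\<alpha> + \<beta>) \<bullet> (\<alpha> + \<beta>)"
    using assms(4,5) by (simp_all add: eq_neg_iff_add_eq_0)
  then have "-2 < \<alpha> \<bullet> \<beta>" "\<alpha> \<bullet> \<beta> < 2"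
    by (simp_all add: inner_diff_left inner_diff_right inner_add_left inner_add_right
        inner_commute norms)
  then have "-2 < n" "n < 2"
    by (simp_all add: n)
  then have "n = -1 \<or> n = 0 \<or> n = 1"
    by arith
  then show ?thesis
    by (auto simp: n)
qed

text \<open>Being outside the span is invariant under adding multiples of \<open>\<tau> i\<close>,
  which suits reflections. The conjunct \<open>u \<notin> range \<tau>\<close> matters here:
  inserting an element of the range would leave the set independent.\<close>

lemma linkage_root_iff_span:
  assumes "independent (range \<tau>)"
  shows "linkage_root \<Phi> \<tau> u \<longleftrightarrow> u \<in> \<Phi> \<and> u \<notin> span (range \<tau>)"
  using assms by (auto simp: linkage_root_def independent_insert intro: span_base)

lemma linkage_root_reflection:
  assumes "root_system \<Phi>" "range \<tau> \<subseteq> \<Phi>" "independent (range \<tau>)" "linkage_root \<Phi> \<tau> u"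
  shows "linkage_root \<Phi> \<tau> (refl_root (\<tau> i) u)"
proof -
  have "u \<in> \<Phi>" and u: "u \<notin> span (range \<tau>)"
    using assms(3,4) by (auto simp: linkage_root_iff_span)
  then have "refl_root (\<tau> i) u \<in> \<Phi>"
    using assms(1,2) unfolding root_system_def by blast
  moreover have "refl_root (\<tau> i) u \<notin> span (range \<tau>)"
  proof
    assume "refl_root (\<tau> i) u \<in> span (range \<tau>)"
    \<comment> \<open>Adding back the multiple of \<open>\<tau> i\<close> that the reflection
      subtracted recovers \<open>u\<close>.\<close>
    then have "refl_root (\<tau> i) u + (2 * (u \<bullet> \<tau> i) / (\<tau> i \<bullet> \<tau> i)) *\<^sub>R \<tau> i \<in> span (range \<tau>)"
      by (intro span_add span_scale) (auto intro: span_base)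
    with u show False
      by (simp add: refl_root_def)
  qed
  ultimately show ?thesis
    using assms(3) by (simp add: linkage_root_iff_span)
qed

lemma linkage_root_label_cases:
  assumes "simply_laced_root_system \<Phi>" "range \<tau> \<subseteq> \<Phi>" "independent (range \<tau>)"
    and "linkage_root \<Phi> \<tau> u"
  shows "label_vector \<tau> u $ k \<in> {-1, 0, 1}"
proof -
  have "u \<in> \<Phi>" "u \<notin> span (range \<tau>)"
    using assms(3,4) by (auto simp: linkage_root_iff_span)
  \<comment> \<open>This rules out \<open>u = \<tau> k\<close> and \<open>u = - \<tau> k\<close>,
    the cases with inner product 2 and -2.\<close>
  moreover have "\<tau> k \<in> span (range \<tau>)" "- \<tau> k \<in> span (range \<tau>)"
    by (auto intro: span_base span_neg)
  ultimately have "u \<bullet> \<tau> k \<in> {-1, 0, 1}"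
    using assms(1,2) by (intro simply_laced_inner_cases[of \<Phi>]) auto
  then show ?thesis
    by (simp add: label_vector_def)
qed

text \<open>Squared length 2 reduces the coefficient in \<open>refl_root\<close> to
  \<open>u \<bullet> \<tau> i\<close>, which is coordinate \<open>i\<close> of the label; pairing
  with \<open>\<tau> k\<close> then gives the dual formula.\<close>

lemma dual_reflection_label_vector:
  assumes "\<tau> i \<bullet> \<tau> i = 2"
  shows "dual_reflection \<tau> i (label_vector \<tau> u) = label_vector \<tau> (refl_root (\<tau> i) u)"
  using assms
  by (simp add: vec_eq_iff dual_reflection_def label_vector_def refl_root_def inner_diff_left)

theorem proposition3p7:
  fixes \<Phi> :: "'a::euclidean_space set"
    and \<Gamma> :: "'n::finite signed_graph"
    and \<tau> :: "'n \<Rightarrow> 'a" and i :: 'n and u :: 'a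
  assumes "simply_laced_root_system \<Phi>"
    and "carter_diagram \<Phi> \<Gamma>"
    and "gamma_set \<Phi> \<Gamma> \<tau>"
    and "linkage_root \<Phi> \<tau> u"
  shows "(\<forall>k. dual_reflection \<tau> i (label_vector \<tau> u) $ k \<in> {-1, 0, 1}) \<and>
         linkage_label_vector \<Phi> \<tau> (dual_reflection \<tau> i (label_vector \<tau> u))"
proof -
  have \<tau>: "range \<tau> \<subseteq> \<Phi>" "independent (range \<tau>)"
    using assms(3) by (auto simp: gamma_set_def)
  have "root_system \<Phi>" "\<tau> i \<bullet> \<tau> i = 2"
    using assms(1) \<tau>(1) by (auto simp: simply_laced_root_system_def)
  then have "linkage_root \<Phi> \<tau> (refl_root (\<tau> i) u)"
    and "dual_reflection \<tau> i (label_vector \<tau> u) = label_vector \<tau> (refl_root (\<tau> i) u)"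
    using \<tau> assms(4) by (auto intro: linkage_root_reflection dual_reflection_label_vector)
  \<comment> \<open>The reflected root serves both conjuncts: its labels are bounded because it is a
    linkage root, and it is the witness for the existential.\<close>
  then show ?thesis
    using linkage_root_label_cases[OF assms(1) \<tau>] by (auto simp: linkage_label_vector_def)
qed

end
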